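(* Let $a<b$ be positive integers and $A=\{a,b,a+b\}$. Let $k=\lfloor (b-1)/(2a)\rfloor$, let $\tilde a=a/\gcd(a,b)$, for $i\ge1$ let $\sigma_i\in\{0,\ldots,a-1\}$ be the residue of $ib$ modulo $a$, and let $\delta_1=0$ and, for $i\geq 2$, $\delta_i=1$ if $\sigma_i>\sigma_{i-1}$ and $\delta_i=0$ otherwise. If the residue of $b$ modulo $2a$ lies in $\{1,\ldots,a-1\}$, then $$(w^A(n))_{n\ge0}=\Big(X_1X_2\cdots X_{\tilde a-1}\,(0^a1^a)^k1^b\Big)^\infty,\qquad X_i=(0^a1^a)^{k-\delta_i}0^{\sigma_i}1^b0^{a-\sigma_i}1^a,$$ and $\operatorname{per}(A)=\tilde a(3b-2ka)$. Otherwise $(w^A(n))_{n\ge0}=\big((0^a1^a)^k0^a1^{a+b}\big)^\infty$ and $\operatorname{per}(A)=b+2a(k+1)$.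
   Context: For a finite nonempty set $A$ of positive integers, $w^A:\mathbb{Z}\to\{0,1\}$ is defined by $w^A(n)=1$ for $n<0$ and $w^A(n)=1-\min\{w^A(n-x):x\in A\}$ for $n\geq 0$ (so $w^A(n)=1$ iff the first player wins the subtraction game with move set $A$ starting from $n$ chips). $\operatorname{per}(A)$ is the least $p\geq1$ such that $w^A(n)=w^A(n+p)$ for all sufficiently large $n$. Notation: juxtaposition is concatenation of binary strings, $0^m,1^m$ are strings of $m$ zeros/ones, $X^m$ is $m$-fold repetition, and $X^\infty$ the infinite repetition of $X$. *)

theory Defs
  imports Main "HOL-Library.Omega_Words_Fun"
begin

text \<open>
  \<open>w A n = 1\<close> iff the first player wins the subtraction game with move set \<open>A\<close> from \<open>n\<close> chips.
  Only finite nonempty sets of positive integers are meant.  The filter \<open>0 < x\<close> just makes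
  the recursion terminate for arbitrary \<open>A\<close>; \<open>w_nonneg\<close> below is the recursion without it.
\<close>
function w :: "nat set \<Rightarrow> int \<Rightarrow> nat" where
  "w A n = (if n < 0 then 1 else 1 - Min ((\<lambda>x. w A (n - int x)) ` {x \<in> A. 0 < x}))"
  by auto
termination
  by (relation "measure (\<lambda>(A, n). nat (n + 1))") auto

declare w.simps [simp del]

lemma w_neg: "n < 0 \<Longrightarrow> w A n = 1"
  by (simp add: w.simps)

lemma w_nonneg:
  assumes "\<forall>x\<in>A. 0 < x" and "n \<ge> 0"
  shows "w A n = 1 - Min {w A (n - int x) |x. x \<in> A}"
proof -
  have "(\<lambda>x. w A (n - int x)) ` {x \<in> A. 0 < x} = {w A (n - int x) |x. x \<in> A}"
    using assms(1) by auto
  then show ?thesis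
    using assms(2) by (subst w.simps) (simp only: not_less [symmetric] if_False)
qed

lemma w_range: "w A n \<in> {0, 1}"
  by (subst w.simps) auto

definition per :: "nat set \<Rightarrow> nat" where
  "per A = (LEAST p. p \<ge> 1 \<and> (\<forall>\<^sub>F n in at_top. w A n = w A (n + int p)))"

definition strpow :: "'a list \<Rightarrow> nat \<Rightarrow> 'a list" where
  "strpow X m = concat (replicate m X)"

definition \<sigma> :: "nat \<Rightarrow> nat \<Rightarrow> nat \<Rightarrow> nat" where
  "\<sigma> a b i = (i * b) mod a"

definition \<delta> :: "nat \<Rightarrow> nat \<Rightarrow> nat \<Rightarrow> nat" where
  "\<delta> a b i = (if i \<ge> 2 \<and> \<sigma> a b i > \<sigma> a b (i - 1) then 1 else 0)"

text \<open>
  The block \<open>X\<^sub>i\<close>.  It is used only when \<open>b mod (2 * a)\<close> lies in \<open>{1..a - 1}\<close>; then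
  \<open>b > 2 * a\<close>, so \<open>k \<ge> 1\<close> and the subtraction of naturals in the exponent does not truncate.
\<close>
definition block :: "nat \<Rightarrow> nat \<Rightarrow> nat \<Rightarrow> nat \<Rightarrow> nat list" where
  "block a b k i =
     strpow (replicate a 0 @ replicate a 1) (k - \<delta> a b i) @
     replicate (\<sigma> a b i) 0 @ replicate b 1 @ replicate (a - \<sigma> a b i) 0 @ replicate a 1"

end

theory Submission
  imports Defs
begin

text \<open>
  Cut the word after every long run of ones instead of at the block boundaries.  It then becomes
  a sequence of chunks: the \<open>i\<close>-th one is a piece of length \<open>L i\<close>, with \<open>b \<le> L i \<le> a + b\<close>, of the
  \<open>2a\<close>-periodic pattern \<open>0\<^sup>a1\<^sup>a0\<^sup>a1\<^sup>a\<dots>\<close>, starting at phase \<open>\<tau> i < a\<close>, followed by \<open>1\<^sup>b\<close>.  The last \<open>b\<close>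
  letters before a chunk are ones, and the phases of consecutive chunks match up modulo \<open>2a\<close>, so
  the three predecessors of a position lie either in its own chunk, in a run of ones, or in the
  previous chunk at the opposite phase; this gives the recurrence of the game by strong induction.
  In the first case of the theorem \<open>\<tau> i = \<sigma>\<^sub>i\<close>, and \<open>L i\<close> is \<open>a + b\<close> or \<open>b\<close> according to whether
  passing from \<open>\<sigma>\<^sub>i\<close> to \<open>\<sigma>\<^sub>i\<^sub>+\<^sub>1\<close> wraps around modulo \<open>a\<close>; the \<open>i\<close>-th chunk starts at
  \<open>i(2b + r) - \<sigma>\<^sub>i\<close>, where \<open>r = b - 2ka\<close>.  In the second case \<open>\<tau> i = 0\<close> and \<open>L i = 2a(k + 1)\<close>.

  The period is minimal because \<open>a + b\<close> consecutive ones occur only directly before a chunk of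
  phase \<open>0\<close>, so any period is a multiple of the distance between such chunks.
\<close>

section \<open>The square wave of period \<open>2 * a\<close> and its finite pieces\<close>

definition phase0 :: "nat \<Rightarrow> nat \<Rightarrow> bool" where
  "phase0 a t \<longleftrightarrow> t mod (2 * a) < a"

lemma phase0_add_period [simp]:
  "phase0 a (t + 2 * a * m) = phase0 a t" "phase0 a (2 * a * m + t) = phase0 a t"
  by (simp_all add: phase0_def)

lemma phase0_add_half:
  assumes "0 < a"
  shows "phase0 a (t + a) \<longleftrightarrow> \<not> phase0 a t"
proof -
  define q u where "q = t div (2 * a)" and "u = t mod (2 * a)"
  have t: "t = u + 2 * a * q" and u: "u < 2 * a"
    using assms by (simp_all add: q_def u_def)
  have "phase0 a (t + a) \<longleftrightarrow> phase0 a (u + a)"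
    using phase0_add_period(1)[of a "u + a" q] by (simp add: t add_ac)
  also have "\<dots> \<longleftrightarrow> \<not> u < a"
  proof (cases "u < a")
    case False
    then have "(u + a) mod (2 * a) = u - a"
      using u by (simp add: le_mod_geq)
    with False u show ?thesis by (simp add: phase0_def)
  qed (simp add: phase0_def)
  finally show ?thesis by (simp add: phase0_def u_def)
qed

lemma phase0_less: "t < a \<Longrightarrow> phase0 a t"
  by (simp add: phase0_def)

lemma not_phase0: "a \<le> t \<Longrightarrow> t < 2 * a \<Longrightarrow> \<not> phase0 a t"
  by (simp add: phase0_def)

lemma phase0_cong: "t mod (2 * a) = u mod (2 * a) \<Longrightarrow> phase0 a (t + x) = phase0 a (u + x)"
  unfolding phase0_def by (metis mod_add_left_eq)

definition pat :: "nat \<Rightarrow> nat \<Rightarrow> nat \<Rightarrow> nat list" where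
  "pat a t l = map (\<lambda>x. if phase0 a (t + x) then 0 else 1) [0..<l]"

lemma map_upt_add: "map f [0..<m + n] = map f [0..<m] @ map (\<lambda>x. f (m + x)) [0..<n]"
  by (induction n) simp_all

lemma pat_add: "pat a t (l + m) = pat a t l @ pat a (t + l) m"
  by (simp add: pat_def map_upt_add add.assoc)

lemma pat_period [simp]: "pat a (2 * a * m + t) l = pat a t l"
  by (simp add: pat_def add.assoc)

lemma pat_zeros: "t + l \<le> a \<Longrightarrow> pat a t l = replicate l 0"
  by (rule nth_equalityI) (auto simp: pat_def phase0_less)

lemma pat_ones: "a \<le> t \<Longrightarrow> t + l \<le> 2 * a \<Longrightarrow> pat a t l = replicate l 1"
  by (rule nth_equalityI) (auto simp: pat_def not_phase0)

lemma pat_strpow: "pat a 0 (2 * a * m) = strpow (replicate a 0 @ replicate a 1) m"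
proof (induction m)
  case (Suc m)
  have "2 * a * Suc m = a + (a + 2 * a * m)" by simp
  then have "pat a 0 (2 * a * Suc m) = pat a 0 a @ pat a a a @ pat a (2 * a * 1 + 0) (2 * a * m)"
    by (simp only: pat_add) (simp add: mult_2)
  then show ?case
    using Suc by (simp only: pat_period) (simp add: pat_zeros pat_ones strpow_def)
qed (simp add: pat_def strpow_def)

section \<open>The game recurrence and the chunk sequences that solve it\<close>

lemma w_eq_0_iff:
  assumes "0 < a" "0 < b" "0 \<le> n"
  shows "w {a, b, a + b} n = 0 \<longleftrightarrow>
    w {a, b, a + b} (n - int a) = 1 \<and> w {a, b, a + b} (n - int b) = 1 \<and>
    w {a, b, a + b} (n - int (a + b)) = 1"
proof -
  let ?w = "w {a, b, a + b}"
  have "{?w (n - int x) |x. x \<in> {a, b, a + b}} = (\<lambda>x. ?w (n - int x)) ` {a, b, a + b}"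
    by blast
  then have "?w n = 1 - min (?w (n - int a)) (min (?w (n - int b)) (?w (n - int (a + b))))"
    using w_nonneg[of "{a, b, a + b}" n] assms by simp
  then show ?thesis
    using w_range[of "{a, b, a + b}" "n - int a"] w_range[of "{a, b, a + b}" "n - int b"]
      w_range[of "{a, b, a + b}" "n - int (a + b)"] by (auto simp: min_def split: if_splits)
qed

text \<open>\<open>indep\<close> prevents the move \<open>b\<close> from linking two zeros of one
  chunk. \<open>domin\<close> serves the closing ones at offset \<open>x = y + b < a + b\<close>: if
  the letter \<open>b\<close> back is a one, the letter \<open>a\<close> back is a zero. The phase
  is taken at \<open>x + a\<close>, where it equals that at \<open>x - a\<close>, to avoid truncated
  subtraction.\<close>

locale chunks =
  fixes a b :: nat and L \<tau> :: "nat \<Rightarrow> nat"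
  assumes a_pos: "0 < a" and a_less_b: "a < b"
    and \<tau>_0: "\<tau> 0 = 0" and \<tau>_less: "\<tau> i < a"
    and L_ge: "b \<le> L i" and L_le: "L i \<le> a + b"
    and \<tau>_step: "(\<tau> i + L i) mod (2 * a) = \<tau> (Suc i)"
    and indep: "y + b < L i \<Longrightarrow> phase0 a (\<tau> i + (y + b)) \<Longrightarrow> \<not> phase0 a (\<tau> i + y)"
    and domin: "L i \<le> y + b \<Longrightarrow> y < a \<Longrightarrow> \<not> phase0 a (\<tau> i + y) \<Longrightarrow> phase0 a (\<tau> i + (y + b + a))"
begin

abbreviation W :: "int \<Rightarrow> nat" where
  "W \<equiv> w {a, b, a + b}"

definition s :: "nat \<Rightarrow> nat" where
  "s i = (\<Sum>j<i. L j + b)"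

lemma s_simps [simp]: "s 0 = 0" "s (Suc i) = s i + L i + b"
  by (simp_all add: s_def)

lemma locate: "\<exists>i x. n = s i + x \<and> x < L i + b"
proof (induction n)
  case 0
  then show ?case using a_pos a_less_b by (intro exI[of _ 0]) simp
next
  case (Suc n)
  then obtain i x where ix: "n = s i + x" "x < L i + b" by blast
  show ?case
  proof (cases "Suc x < L i + b")
    case True
    then show ?thesis using ix by (intro exI[of _ i] exI[of _ "Suc x"]) simp
  next
    case False
    then show ?thesis using ix a_pos a_less_b
      by (intro exI[of _ "Suc i"] exI[of _ 0]) simp
  qed
qed

definition val :: "nat \<Rightarrow> nat \<Rightarrow> nat" where
  "val i x = (if x < L i \<and> phase0 a (\<tau> i + x) then 0 else 1)"

text \<open>Stepping back \<open>a + b\<close> skips the \<open>b\<close> closing ones, over which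
  the phase does not advance, so the phase moves by exactly half a period.\<close>

lemma phase0_before_chunk:
  assumes "x < a"
  shows "phase0 a (\<tau> i + (L i - (a - x))) \<longleftrightarrow> \<not> phase0 a (\<tau> (Suc i) + x)"
proof -
  have "\<tau> i + (L i - (a - x)) + a = \<tau> i + L i + x"
    using assms L_ge[of i] a_less_b by simp
  moreover have "phase0 a (\<tau> i + L i + x) \<longleftrightarrow> phase0 a (\<tau> (Suc i) + x)"
    using \<tau>_step[of i] \<tau>_less[of "Suc i"] by (intro phase0_cong) simp
  ultimately show ?thesis
    using phase0_add_half[OF a_pos, of "\<tau> i + (L i - (a - x))"] by metis
qed

lemma W_chunk:
  assumes "x < L i + b"
  shows "W (int (s i + x)) = val i x"
  using assms
proof (induction "s i + x" arbitrary: i x rule: less_induct)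
  case less
  let ?n = "int (s i + x)"
  have same: "W (?n - int y) = val i (x - y)" if "0 < y" "y \<le> x" for y
  proof -
    have "?n - int y = int (s i + (x - y))" using that by simp
    then show ?thesis using less.hyps[of i "x - y"] that less.prems by simp
  qed
  \<comment> \<open>Such a predecessor is one of the \<open>b\<close> closing ones of the previous
    chunk, or is negative, where the word is 1 by convention.\<close>
  have tail: "W (?n - int y) = 1" if "x < y" "y \<le> x + b" for y
  proof (cases i)
    case 0
    then show ?thesis using that by (intro w_neg) simp
  next
    case (Suc j)
    define z where "z = b + x - y"
    have "?n - int y = int (s j + (L j + z))" "z < b" using that Suc by (simp_all add: z_def)
    then show ?thesis
      using less.hyps[of j "L j + z"] that Suc by (simp only:) (simp add: val_def)
  qed
  \<comment> \<open>Chunk \<open>0\<close> fits in: the negative argument gives 1, and its first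
    \<open>a\<close> offsets have zero phase because \<open>\<tau> 0 = 0\<close>.\<close>
  have before: "W (?n - int (a + b)) = (if phase0 a (\<tau> i + x) then 1 else 0)" if "x < a"
  proof (cases i)
    case 0
    then show ?thesis
      using that \<tau>_0 phase0_less[of x a] by (subst w_neg) auto
  next
    case (Suc j)
    define z where "z = L j - (a - x)"
    have z: "?n - int (a + b) = int (s j + z)" "z < L j" "s j + z < s i + x"
      using that Suc L_ge[of j] a_less_b by (simp_all add: z_def)
    have "W (int (s j + z)) = val j z"
      using z by (intro less.hyps) auto
    then show ?thesis
      using phase0_before_chunk[OF that, of j] z Suc
      by (simp only: z_def[symmetric]) (simp add: val_def)
  qed
  note half = phase0_add_half[OF a_pos]
  have shift: "phase0 a (\<tau> i + x) \<longleftrightarrow> \<not> phase0 a (\<tau> i + (x - a))" if "a \<le> x"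
    using half[of "\<tau> i + (x - a)"] that by simp
  have iff: "W ?n = 0 \<longleftrightarrow> W (?n - int a) = 1 \<and> W (?n - int b) = 1 \<and> W (?n - int (a + b)) = 1"
    using a_pos a_less_b by (intro w_eq_0_iff) auto
  have "W ?n = 0 \<longleftrightarrow> val i x = 0"
  proof (cases "val i x = 0")
    case True
    then have x: "x < L i" "phase0 a (\<tau> i + x)" by (auto simp: val_def split: if_splits)
    have "W (?n - int a) = 1"
      using same[of a] tail[of a] a_pos a_less_b shift x by (cases "x < a") (auto simp: val_def)
    moreover have "W (?n - int b) = 1"
    proof (cases "x < b")
      case True
      then show ?thesis using tail[of b] by simp
    next
      case False
      then show ?thesis
        using same[of b] indep[of "x - b" i] x a_pos a_less_b by (simp add: val_def)
    qed
    moreover have "W (?n - int (a + b)) = 1"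
      using before tail[of "a + b"] x L_le[of i] by (cases "x < a") auto
    ultimately show ?thesis using iff True by simp
  next
    case False
    then have x: "x < L i \<Longrightarrow> \<not> phase0 a (\<tau> i + x)" by (auto simp: val_def split: if_splits)
    \<comment> \<open>A one needs a zero predecessor. In the patterned part it is found at distance
      \<open>a\<close>, or at distance \<open>a + b\<close> if \<open>a\<close> would cross the
      chunk start.\<close>
    have "W (?n - int a) = 0 \<or> W (?n - int b) = 0 \<or> W (?n - int (a + b)) = 0"
    proof (cases "x < L i")
      case True
      then show ?thesis
        using before same[of a] a_pos shift x by (cases "x < a") (auto simp: val_def)
    next
      case xL: False
      then have bx: "b \<le> x" "x - b < L i" using L_ge[of i] less.prems by auto
      have Wb: "W (?n - int b) = (if phase0 a (\<tau> i + (x - b)) then 0 else 1)"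
        using same[of b] bx a_pos a_less_b by (simp add: val_def)
      \<comment> \<open>The letter \<open>b\<close> back is a one. A further \<open>a\<close> back
        the phase is opposite, giving a zero if that is still in the chunk; otherwise
        \<open>domin\<close> applies.\<close>
      have "W (?n - int a) = 0 \<or> W (?n - int (a + b)) = 0" if np: "\<not> phase0 a (\<tau> i + (x - b))"
      proof (cases "a + b \<le> x")
        case True
        have "\<tau> i + (x - (a + b)) + a = \<tau> i + (x - b)" using True by simp
        then have "phase0 a (\<tau> i + (x - (a + b)))" using np half by metis
        moreover have "x - (a + b) < L i" using bx by linarith
        ultimately show ?thesis
          using same[of "a + b"] True a_pos by (simp only: val_def) simp
      next
        case False
        then have "phase0 a (\<tau> i + (x + a))"
          using domin[of i "x - b"] np bx xL by simp
        then have "phase0 a (\<tau> i + (x - a))"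
          using half[of "\<tau> i + x"] half[of "\<tau> i + (x - a)"] bx a_less_b by (simp add: add.assoc)
        then show ?thesis
          using same[of a] False bx a_pos a_less_b xL L_ge[of i] by (auto simp: val_def)
      qed
      then show ?thesis using Wb by auto
    qed
    then show ?thesis using iff False by auto
  qed
  then show ?case
    using w_range[of "{a, b, a + b}" ?n] by (auto simp: val_def)
qed

lemma chunk_list:
  "map (\<lambda>n. W (int n)) [0..<s i] =
     concat (map (\<lambda>j. pat a (\<tau> j) (L j) @ replicate b 1) [0..<i])"
proof (induction i)
  case (Suc i)
  have "map (\<lambda>x. W (int (s i + x))) [0..<L i + b] = map (val i) [0..<L i + b]"
    by (rule map_cong) (use W_chunk[of _ i] in auto)
  also have "\<dots> = map (val i) [0..<L i] @ map (\<lambda>x. val i (L i + x)) [0..<b]"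
    by (rule map_upt_add)
  also have "map (\<lambda>x. val i (L i + x)) [0..<b] = replicate b 1"
    by (rule nth_equalityI) (auto simp: val_def)
  also have "map (val i) [0..<L i] = pat a (\<tau> i) (L i)"
    by (auto simp: val_def pat_def)
  finally show ?case
    using Suc map_upt_add[of "\<lambda>n. W (int n)" "s i" "L i + b"] by (simp add: add.assoc)
qed simp

text \<open>The last \<open>b\<close> letters are the closing run. The \<open>a\<close> letters
  before it complete a period of the wave, since the phase reached is 0, and so are ones.\<close>

lemma ones_before_start:
  assumes "\<tau> (Suc i) = 0" "0 < y" "y \<le> a + b"
  shows "W (int (s (Suc i)) - int y) = 1"
proof -
  have e: "int (s (Suc i)) - int y = int (s i + (L i + b - y))"
    using assms L_ge[of i] a_less_b by simp
  have "val i (L i + b - y) = 1"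
  proof (cases "y \<le> b")
    case False
    then have "\<not> phase0 a (\<tau> i + (L i - (a - (a + b - y))))"
      using phase0_before_chunk[of "a + b - y" i] assms phase0_less[of "a + b - y" a] by simp
    moreover have "L i - (a - (a + b - y)) = L i + b - y"
      using False assms L_ge[of i] a_less_b by simp
    ultimately show ?thesis by (simp add: val_def)
  next
    case True
    then have "\<not> L i + b - y < L i" by simp
    then show ?thesis by (simp only: val_def) simp
  qed
  then show ?thesis
    unfolding e using assms L_ge[of i] a_less_b by (subst W_chunk) simp_all
qed

lemma start_if_ones_before:
  assumes ones: "\<And>y. 0 < y \<Longrightarrow> y \<le> a + b \<Longrightarrow> W (int N - int y) = 1" and N: "0 < N"
  shows "\<exists>i. N = s i \<and> \<tau> i = 0"
proof -
  obtain i x where ix: "N - 1 = s i + x" "x < L i + b" using locate by blast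
  have one: "\<not> phase0 a (\<tau> i + z)" if "z < L i" "z \<le> x" "x < z + a + b" for z
  proof -
    have "int (s i + z) = int N - int (x + 1 - z)"
      using that ix N by simp
    then have "W (int (s i + z)) = 1"
      using ones[of "x + 1 - z"] that by (simp only:)
    then show ?thesis
      using W_chunk[of z i] that by (simp add: val_def split: if_splits)
  qed
  note half = phase0_add_half[OF a_pos]
  \<comment> \<open>A window ending in the patterned part would contain offset 0, a zero, or two
    offsets at distance \<open>a\<close>, of opposite phases.\<close>
  have xL: "L i \<le> x"
  proof (rule ccontr)
    assume x: "\<not> L i \<le> x"
    show False
    proof (cases "x < a")
      case True
      then show False using one[of 0] phase0_less[OF \<tau>_less[of i]] x by simp
    next
      case False
      then show False
        using one[of x] one[of "x - a"] half[of "\<tau> i + (x - a)"] x a_pos a_less_b by simp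
    qed
  qed
  \<comment> \<open>Ending before the last closing one, the window would reach back over offsets
    \<open>L i - 1\<close> and \<open>L i - 1 - a\<close>, of opposite phases.\<close>
  have x: "x = L i + b - 1"
  proof (rule ccontr)
    assume "x \<noteq> L i + b - 1"
    then show False
      using one[of "L i - 1"] one[of "L i - 1 - a"] half[of "\<tau> i + (L i - 1 - a)"] xL ix L_ge[of i]
        a_pos a_less_b by simp
  qed
  \<comment> \<open>The last patterned letter has the phase just before
    \<open>\<tau> (Suc i)\<close>; if the latter is positive, that letter is a zero inside the
    window.\<close>
  have "\<tau> (Suc i) = 0"
  proof (rule ccontr)
    assume "\<tau> (Suc i) \<noteq> 0"
    then have 1: "phase0 a (\<tau> (Suc i) - 1)" using \<tau>_less[of "Suc i"] by (intro phase0_less) simp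
    have 2: "phase0 a (\<tau> i + (L i - 1)) \<longleftrightarrow> phase0 a (\<tau> (Suc i) + (a - 1) + a)"
      using phase0_before_chunk[of "a - 1" i] half[of "\<tau> (Suc i) + (a - 1)"] a_pos by simp
    have 3: "\<tau> (Suc i) + (a - 1) + a = (\<tau> (Suc i) - 1) + 2 * a * 1"
      using \<open>\<tau> (Suc i) \<noteq> 0\<close> a_pos by simp
    have "phase0 a (\<tau> i + (L i - 1))"
      unfolding 2 3 phase0_add_period by (rule 1)
    moreover have "L i - 1 < L i" "L i - 1 \<le> x" "x < L i - 1 + a + b"
      using x L_ge[of i] a_pos a_less_b by linarith+
    ultimately show False using one by blast
  qed
  moreover have "N = s (Suc i)" using ix x N a_less_b by simp
  ultimately show ?thesis by blast
qed

end

section \<open>Periodic chunk sequences and their least period\<close>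

locale periodic_chunks = chunks +
  fixes d :: nat
  assumes d_pos: "0 < d" and L_period: "L (i + d) = L i" and \<tau>_period: "\<tau> (i + d) = \<tau> i"
    and \<tau>_eq_0: "\<tau> i = 0 \<longleftrightarrow> d dvd i"
begin

lemma s_add: "s (i + d) = s i + s d"
  by (induction i) (simp_all add: L_period)

lemma s_mult: "s (m * d) = m * s d"
  by (induction m) (simp_all add: s_add add.commute[of d])

lemma s_pos: "0 < s d"
proof -
  obtain e where "d = Suc e" using d_pos by (cases d) auto
  then show ?thesis using a_less_b by simp
qed

lemma W_period: "W (int (n + s d)) = W (int n)"
proof -
  obtain i x where "n = s i + x" "x < L i + b" using locate by blast
  moreover from this have "n + s d = s (i + d) + x" by (simp add: s_add)
  ultimately show ?thesis
    using W_chunk[of x i] W_chunk[of x "i + d"]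
    by (simp only: val_def L_period \<tau>_period)
qed

lemma W_mod: "W (int (n mod s d)) = W (int n)"
proof -
  have "W (int (x + m * s d)) = W (int x)" for x m
  proof (induction m)
    case (Suc m)
    then show ?case using W_period[of "x + m * s d"] by (simp add: add_ac)
  qed simp
  from this[of "n mod s d" "n div s d"] show ?thesis by simp
qed

lemma W_omega:
  "(\<lambda>n. W (int n)) = (concat (map (\<lambda>j. pat a (\<tau> j) (L j) @ replicate b 1) [0..<d]))\<^sup>\<omega>"
  unfolding chunk_list[symmetric] iter_def using s_pos by (auto simp: fun_eq_iff W_mod)

lemma per_eq: "per {a, b, a + b} = s d"
  unfolding per_def
proof (rule Least_equality)
  have "W n = W (n + int (s d))" if "0 \<le> n" for n
    using W_period[of "nat n"] that by simp
  then show "1 \<le> s d \<and> (\<forall>\<^sub>F n in at_top. W n = W (n + int (s d)))"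
    using s_pos by (auto simp: eventually_at_top_linorder)
next
  fix p
  assume p: "1 \<le> p \<and> (\<forall>\<^sub>F n in at_top. W n = W (n + int p))"
  then obtain n0 where n0: "\<And>n. n0 \<le> n \<Longrightarrow> W n = W (n + int p)"
    by (auto simp: eventually_at_top_linorder)
  \<comment> \<open>Chosen so that the \<open>a + b\<close> positions before the phase-0 start
    \<open>s (m * d)\<close> all lie where \<open>p\<close> already acts as a period, and so that a
    previous chunk exists.\<close>
  define m where "m = Suc (nat n0 + a + b)"
  have "m * d \<noteq> 0" using d_pos by (simp add: m_def)
  then obtain i where i: "m * d = Suc i" by (cases "m * d") auto
  have "m \<le> s (m * d)" using s_pos by (simp add: s_mult)
  then have large: "n0 \<le> int (s (m * d)) - int y" if "y \<le> a + b" for y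
    using that by (simp add: m_def)
  have "W (int (s (m * d) + p) - int y) = 1" if "0 < y" "y \<le> a + b" for y
  proof -
    have "\<tau> (m * d) = 0" by (simp add: \<tau>_eq_0)
    then have "W (int (s (m * d)) - int y) = 1"
      using ones_before_start[of i y] that by (simp only: i)
    then show ?thesis using n0[OF large[OF that(2)]] by (simp add: algebra_simps)
  qed
  \<comment> \<open>The shifted window of ones again ends at a phase-0 start, and by
    \<open>\<tau>_eq_0\<close> these are the multiples of \<open>s d\<close>.\<close>
  then obtain j where j: "s (m * d) + p = s j" "\<tau> j = 0"
    using start_if_ones_before[of "s (m * d) + p"] p by auto
  then obtain q where "j = q * d" by (auto simp: \<tau>_eq_0 dvd_def mult.commute)
  then have "p = (q - m) * s d" using j by (simp add: s_mult diff_mult_distrib)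
  then show "s d \<le> p" using p by (cases "q - m") auto
qed

end

section \<open>Residues of the multiples of \<open>b\<close>, and the two instances of the chunk
  scheme\<close>

lemma \<sigma>_Suc:
  assumes "b = 2 * a * k + r" "r < a"
  shows "\<sigma> a b (Suc i) = (if \<sigma> a b i + r < a then \<sigma> a b i + r else \<sigma> a b i + r - a)"
proof -
  have "Suc i * b = i * b + (r + a * (2 * k))" using assms(1) by simp
  then have "\<sigma> a b (Suc i) = (\<sigma> a b i + (r + a * (2 * k))) mod a"
    by (simp only: \<sigma>_def mod_add_left_eq)
  also have "\<dots> = (\<sigma> a b i + r) mod a"
    by (metis add.assoc mod_mult_self2)
  moreover have "\<sigma> a b i < a" using assms by (simp add: \<sigma>_def)
  ultimately show ?thesis using assms(2) by (simp add: mod_if)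
qed

text \<open>Divide \<open>a dvd i * b\<close> by the gcd; the quotients of \<open>a\<close> and
  \<open>b\<close> are coprime.\<close>

lemma \<sigma>_eq_0_iff:
  assumes "0 < a"
  shows "\<sigma> a b i = 0 \<longleftrightarrow> a div gcd a b dvd i"
proof -
  define g where "g = gcd a b"
  have g: "0 < g" "g * (a div g) = a" "g * (b div g) = b" "coprime (a div g) (b div g)"
    using assms by (auto simp: g_def intro: div_gcd_coprime)
  have "i * b = g * (i * (b div g))" by (metis g(3) mult.left_commute)
  then have "\<sigma> a b i = 0 \<longleftrightarrow> g * (a div g) dvd g * (i * (b div g))"
    by (simp only: g(2) \<sigma>_def mod_eq_0_iff_dvd)
  also have "\<dots> \<longleftrightarrow> a div g dvd i * (b div g)"
    using g(1) by simp
  also have "\<dots> \<longleftrightarrow> a div g dvd i"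
    by (rule coprime_dvd_mult_left_iff[OF g(4)])
  finally show ?thesis by (simp add: g_def)
qed

text \<open>Modulo \<open>2 * a\<close>, length \<open>b\<close> advances the phase by
  \<open>r\<close> and length \<open>a + b\<close> by \<open>r - a\<close>, which is the wrapped
  step of \<open>\<sigma>\<close>.\<close>

lemma periodic_chunks_small_residue:
  assumes b: "b = 2 * a * k + r" and r: "0 < r" "r < a" and k: "0 < k"
  shows "periodic_chunks a b (\<lambda>i. if \<sigma> a b i + r < a then b else a + b) (\<sigma> a b) (a div gcd a b)"
proof
  have "a \<le> 2 * a * k" using k by (cases k) simp_all
  then show "a < b" using b r by linarith
  show a: "0 < a" using r by simp
  show "\<sigma> a b 0 = 0" by (simp add: \<sigma>_def)
  show less: "\<sigma> a b i < a" for i using a by (simp add: \<sigma>_def)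
  show "b \<le> (if \<sigma> a b i + r < a then b else a + b)"
    "(if \<sigma> a b i + r < a then b else a + b) \<le> a + b" for i by auto
  show "(\<sigma> a b i + (if \<sigma> a b i + r < a then b else a + b)) mod (2 * a) = \<sigma> a b (Suc i)" for i
  proof (cases "\<sigma> a b i + r < a")
    case True
    have e: "\<sigma> a b i + b = (\<sigma> a b i + r) + 2 * a * k" using b by simp
    have "(\<sigma> a b i + b) mod (2 * a) = (\<sigma> a b i + r) mod (2 * a)"
      unfolding e by (rule mod_mult_self2)
    then show ?thesis using True \<sigma>_Suc[OF b r(2), of i] by simp
  next
    case False
    then have e: "\<sigma> a b i + (a + b) = (\<sigma> a b i + r - a) + 2 * a * (k + 1)" using b by simp
    have "(\<sigma> a b i + (a + b)) mod (2 * a) = (\<sigma> a b i + r - a) mod (2 * a)"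
      unfolding e by (rule mod_mult_self2)
    then show ?thesis using False less[of i] r \<sigma>_Suc[OF b r(2), of i] by simp
  qed
  show "\<not> phase0 a (\<sigma> a b i + y)"
    if "y + b < (if \<sigma> a b i + r < a then b else a + b)" "phase0 a (\<sigma> a b i + (y + b))" for i y
  proof -
    \<comment> \<open>Length \<open>b\<close> leaves no room for \<open>y + b\<close>, so this chunk
      wraps around.\<close>
    have y: "y < a" "a \<le> \<sigma> a b i + r" using that(1) by (auto split: if_splits)
    have "\<sigma> a b i + (y + b) = (\<sigma> a b i + y + r) + 2 * a * k" using b by simp
    then have "phase0 a (\<sigma> a b i + y + r)" using that(2) by (simp only: phase0_add_period)
    then have "2 * a \<le> \<sigma> a b i + y + r" using not_phase0[of a "\<sigma> a b i + y + r"] y by linarith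
    then show ?thesis using r y less[of i] by (intro not_phase0) auto
  qed
  show "phase0 a (\<sigma> a b i + (y + b + a))"
    if "(if \<sigma> a b i + r < a then b else a + b) \<le> y + b" "y < a" "\<not> phase0 a (\<sigma> a b i + y)" for i y
  proof -
    \<comment> \<open>Length \<open>a + b\<close> would exceed \<open>y + b\<close>, so this chunk
      does not wrap around.\<close>
    have y: "a \<le> \<sigma> a b i + y" "\<sigma> a b i + r < a"
      using that phase0_less[of "\<sigma> a b i + y" a] by (force split: if_splits)+
    have "\<sigma> a b i + (y + b + a) = (\<sigma> a b i + y + r - a) + 2 * a * (k + 1)" using b y by simp
    then show ?thesis
      using y that(2) by (simp only: phase0_add_period) (intro phase0_less, linarith)
  qed
  show "0 < a div gcd a b" using a by (simp add: div_greater_zero_iff gcd_le1_nat)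
  have "a dvd a div gcd a b * b"
    by (metis dvd_div_mult dvd_mult_div_cancel dvd_triv_left gcd_dvd1 gcd_dvd2 mult.commute)
  then have per: "\<sigma> a b (i + a div gcd a b) = \<sigma> a b i" for i
    by (auto simp: \<sigma>_def distrib_right elim: dvdE)
  show "\<sigma> a b (i + a div gcd a b) = \<sigma> a b i"
    "(if \<sigma> a b (i + a div gcd a b) + r < a then b else a + b) =
      (if \<sigma> a b i + r < a then b else a + b)"
    "\<sigma> a b i = 0 \<longleftrightarrow> a div gcd a b dvd i" for i
    using \<sigma>_eq_0_iff[OF a] by (simp_all only: per)
qed

text \<open>The value \<open>r = 2 * a\<close> stands for residue 0. The bounds on \<open>r\<close>
  are exactly those on the length, \<open>indep\<close> holds because \<open>y + r\<close> stays in
  \<open>[a, 2a)\<close>, and \<open>domin\<close> is vacuous at phase 0.\<close>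

lemma periodic_chunks_large_residue:
  assumes b: "b = 2 * a * k + r" and r: "a \<le> r" "r \<le> 2 * a" and a: "0 < a" "a < b"
  shows "periodic_chunks a b (\<lambda>_. 2 * a * (k + 1)) (\<lambda>_. 0) 1"
proof
  show "\<not> phase0 a (0 + y)" if "y + b < 2 * a * (k + 1)" "phase0 a (0 + (y + b))" for y
  proof -
    have "0 + (y + b) = (y + r) + 2 * a * k" using b by simp
    then have "phase0 a (y + r)" using that(2) by (simp only: phase0_add_period)
    then show ?thesis using that(1) b r not_phase0[of a "y + r"] by simp
  qed
  show "phase0 a (0 + (y + b + a))" if "y < a" "\<not> phase0 a (0 + y)" for y
    using that phase0_less[of y a] by simp
qed (use assms in auto)

text \<open>
  \<open>X\<^sub>i\<^sub>+\<^sub>1\<close> straddles two chunks: \<open>rest i\<close> is chunk \<open>i\<close> without its leading \<open>0\<close>-run and \<open>1\<^sup>a\<close>.  Chunk \<open>0\<close> is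
  all of \<open>rest 0\<close>, because the convention \<open>\<delta>\<^sub>1 = 0\<close> leaves one more copy of \<open>0\<^sup>a1\<^sup>a\<close> there.
\<close>
definition rest :: "nat \<Rightarrow> nat \<Rightarrow> nat \<Rightarrow> nat \<Rightarrow> nat list" where
  "rest a b k i = strpow (replicate a 0 @ replicate a 1) (k - \<delta> a b (Suc i)) @
     replicate (\<sigma> a b (Suc i)) 0 @ replicate b 1"

lemma block_Suc:
  "block a b k (Suc i) =
    rest a b k i @ replicate (a - \<sigma> a b (Suc i)) 0 @ replicate a 1"
  by (simp add: block_def rest_def)

lemma chunk_eq_rest:
  assumes b: "b = 2 * a * k + r" and r: "0 < r" "r < a" and k: "0 < k"
  shows "pat a (\<sigma> a b i) (if \<sigma> a b i + r < a then b else a + b) @ replicate b 1 =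
    (if i = 0 then [] else replicate (a - \<sigma> a b i) 0 @ replicate a 1) @ rest a b k i"
proof -
  have less: "\<sigma> a b j < a" for j using r by (simp add: \<sigma>_def)
  have tail: "pat a 0 (2 * a * m + \<sigma> a b (Suc i)) =
    strpow (replicate a 0 @ replicate a 1) m @ replicate (\<sigma> a b (Suc i)) 0" for m
    using less[of "Suc i"] pat_period[of a m 0 "\<sigma> a b (Suc i)"]
    by (simp add: pat_add pat_strpow pat_zeros)
  show ?thesis
  proof (cases "i = 0")
    case True
    have "\<sigma> a b 0 = 0" "\<sigma> a b (Suc 0) = r" "\<delta> a b (Suc 0) = 0"
      using \<sigma>_Suc[OF b r(2), of 0] r by (simp_all add: \<sigma>_def \<delta>_def)
    then show ?thesis using True tail[of k] r b by (simp add: rest_def)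
  next
    case False
    define l where "l = 2 * a * (k - \<delta> a b (Suc i)) + \<sigma> a b (Suc i)"
    \<comment> \<open>Since \<open>0 < r < a\<close>, the residue rises exactly when the step does
      not wrap around.\<close>
    have \<delta>: "\<delta> a b (Suc i) = (if \<sigma> a b i + r < a then 1 else 0)"
      using False \<sigma>_Suc[OF b r(2), of i] less[of i] r by (auto simp: \<delta>_def)
    have k': "2 * a * (k - 1) + 2 * a = 2 * a * k" using k by (cases k) simp_all
    have "(if \<sigma> a b i + r < a then b else a + b) = (a - \<sigma> a b i) + (a + l)"
    proof (cases "\<sigma> a b i + r < a")
      case True
      then have "l = 2 * a * (k - 1) + (\<sigma> a b i + r)"
        using \<sigma>_Suc[OF b r(2), of i] by (simp add: l_def \<delta>)
      then have "b = (a - \<sigma> a b i) + (a + l)"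
        using k' b less[of i] by linarith
      then show ?thesis by (simp only: True if_True)
    next
      case False
      then have "l = 2 * a * k + (\<sigma> a b i + r - a)"
        using \<sigma>_Suc[OF b r(2), of i] by (simp add: l_def \<delta>)
      then have "a + b = (a - \<sigma> a b i) + (a + l)"
        using False b less[of i] by linarith
      then show ?thesis by (simp only: False if_False)
    qed
    \<comment> \<open>Cut where the phase reaches \<open>a\<close> and then
      \<open>2 * a\<close>.\<close>
    moreover have "pat a (\<sigma> a b i) ((a - \<sigma> a b i) + (a + l)) =
      pat a (\<sigma> a b i) (a - \<sigma> a b i) @ pat a a a @ pat a (2 * a * 1 + 0) l"
      using less[of i] by (simp only: pat_add) (simp add: mult_2)
    ultimately show ?thesis
      using False less[of i] tail[of "k - \<delta> a b (Suc i)"]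
      by (simp only: pat_period) (simp add: pat_zeros pat_ones rest_def l_def)
  qed
qed

text \<open>The rest of each chunk joins the head of the next one to form a block; only the last
  rest is left over.\<close>

lemma concat_chunks_eq_blocks:
  assumes "b = 2 * a * k + r" "0 < r" "r < a" "0 < k"
  shows "concat (map (\<lambda>i. pat a (\<sigma> a b i) (if \<sigma> a b i + r < a then b else a + b) @ replicate b 1)
      [0..<Suc n]) = concat (map (block a b k) [1..<Suc n]) @ rest a b k n"
  (is "concat (map ?c _) = _ n")
proof (induction n)
  case 0
  show ?case using chunk_eq_rest[OF assms, of 0] by simp
next
  case (Suc n)
  have "?c (Suc n) = replicate (a - \<sigma> a b (Suc n)) 0 @ replicate a 1 @ rest a b k (Suc n)"
    by (simp only: chunk_eq_rest[OF assms]) simp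
  moreover have "concat (map ?c [0..<Suc (Suc n)]) = concat (map ?c [0..<Suc n]) @ ?c (Suc n)"
    by simp
  moreover have "[1..<Suc (Suc n)] = [1..<Suc n] @ [Suc n]" by simp
  ultimately show ?case
    using Suc by (simp only: block_Suc map_append concat_append list.map concat.simps
      append_assoc append_Nil append_Nil2)
qed

theorem theorem5p1:
  fixes a b k a' :: nat and A :: "nat set"
  assumes "0 < a" and "a < b"
    and "A = {a, b, a + b}"
    and "k = (b - 1) div (2 * a)"
    and "a' = a div gcd a b"
  shows "(b mod (2 * a) \<in> {1..a - 1} \<longrightarrow>
           (\<lambda>n. w A (int n)) =
             (concat (map (block a b k) [1..<a']) @
              strpow (replicate a 0 @ replicate a 1) k @ replicate b 1)\<^sup>\<omega> \<and>
           int (per A) = int a' * (3 * int b - 2 * int k * int a))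
       \<and> (b mod (2 * a) \<notin> {1..a - 1} \<longrightarrow>
           (\<lambda>n. w A (int n)) =
             (strpow (replicate a 0 @ replicate a 1) k @ replicate a 0 @ replicate (a + b) 1)\<^sup>\<omega> \<and>
           per A = b + 2 * a * (k + 1))"
proof -
  \<comment> \<open>The remainder is taken in \<open>1..2a\<close>, to match the
    \<open>b - 1\<close> in \<open>k\<close>.\<close>
  define r where "r = Suc ((b - 1) mod (2 * a))"
  have "b = Suc (2 * a * k + (b - 1) mod (2 * a))"
    using assms by (simp add: mult_div_mod_eq)
  then have b: "b = 2 * a * k + r" by (simp add: r_def)
  have r: "0 < r" "r \<le> 2 * a" using assms(1) by (simp_all add: r_def Suc_le_eq)
  have bmod: "b mod (2 * a) = r mod (2 * a)" using b by simp
  show ?thesis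
  proof (cases "r < a")
    case True
    then have small: "b mod (2 * a) \<in> {1..a - 1}" using r bmod by auto
    have k: "0 < k" using b assms(2) True by (cases k) auto
    let ?L = "\<lambda>i. if \<sigma> a b i + r < a then b else a + b"
    interpret periodic_chunks a b ?L "\<sigma> a b" a'
      unfolding assms(5) by (rule periodic_chunks_small_residue[OF b r(1) True k])
    obtain n where n: "a' = Suc n" using d_pos by (cases a') auto
    have \<sigma>_a': "\<sigma> a b a' = 0" by (simp add: \<tau>_eq_0)
    \<comment> \<open>The residue has returned to 0, so it did not rise and
      \<open>\<delta> a b a' = 0\<close>.\<close>
    then have "rest a b k n = strpow (replicate a 0 @ replicate a 1) k @ replicate b 1"
      by (simp add: rest_def \<delta>_def n)
    then have word: "(\<lambda>n. w A (int n)) = (concat (map (block a b k) [1..<a']) @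
      strpow (replicate a 0 @ replicate a 1) k @ replicate b 1)\<^sup>\<omega>"
      using W_omega concat_chunks_eq_blocks[OF b r(1) True k, of n]
      by (simp only: assms(3) n)
    \<comment> \<open>A wrap-around lengthens the chunk by \<open>a\<close> and lowers the residue
      by \<open>a\<close>, so the sum grows evenly.\<close>
    have "s i + \<sigma> a b i = i * (2 * b + r)" for i
    proof (induction i)
      case (Suc i)
      then show ?case using \<sigma>_Suc[OF b True, of i] \<tau>_less[of i] by simp
    qed (simp add: \<tau>_0)
    from this[of a'] have "per A = a' * (2 * b + r)"
      using \<sigma>_a' per_eq assms(3) by simp
    moreover have "3 * int b - 2 * int k * int a = int (2 * b + r)"
      using b by simp
    ultimately show ?thesis using small word by (simp only: of_nat_mult) simp
  next
    case False
    then have large: "b mod (2 * a) \<notin> {1..a - 1}"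
      using r bmod assms(1) by (cases "r = 2 * a") auto
    interpret periodic_chunks a b "\<lambda>_. 2 * a * (k + 1)" "\<lambda>_. 0" 1
      using False by (intro periodic_chunks_large_residue[OF b _ r(2)] assms) simp
    have "pat a 0 (2 * a * (k + 1)) = pat a 0 (2 * a * k) @ pat a (2 * a * k + 0) (a + a)"
      using pat_add[of a 0 "2 * a * k" "a + a"] by (simp add: algebra_simps)
    also have "\<dots> = strpow (replicate a 0 @ replicate a 1) k @ replicate a 0 @ replicate a 1"
      by (simp only: pat_period) (simp add: pat_add pat_strpow pat_zeros pat_ones)
    finally have "(\<lambda>n. w A (int n)) =
      (strpow (replicate a 0 @ replicate a 1) k @ replicate a 0 @ replicate (a + b) 1)\<^sup>\<omega>"
      using W_omega by (simp add: assms(3) replicate_add)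
    moreover have "per A = b + 2 * a * (k + 1)"
      using per_eq s_simps(2)[of 0] s_simps(1) assms(3) by simp
    ultimately show ?thesis using large by blast
  qed
qed

end
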